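(* Let $K=3$, $d=2$, let $X\in\mathbb{R}^{3\times2}$ have rows $x_1=(3,4)^\top$, $x_2=(5,6)^\top$, $x_3=(1,2)^\top$, and let $r=(3,2,1)^\top$. Then the rewards are pairwise distinct and $\langle x_2-x_3,\,x_1-x_3\rangle>0$, but there is no $w\in\mathbb{R}^2$ such that $r'=Xw$ satisfies, for all $i,j$, $r'(i)>r'(j)$ if and only if $r(i)>r(j)$. Moreover, the optimal reward cannot be achieved by any finite or infinite parameters: there is no $\theta\in\mathbb{R}^2$ with $\langle\pi_\theta,r\rangle=r(1)$ and no sequence $(\theta_n)$ in $\mathbb{R}^2$ with $\langle\pi_{\theta_n},r\rangle\to r(1)$. Consequently, for every initialization $\theta_1\in\mathbb{R}^2$ and every learning rate $\eta>0$, the iterates $\theta_{t+1}=\theta_t+\eta\,X^\top(\mathrm{diag}(\pi_{\theta_t})-\pi_{\theta_t}\pi_{\theta_t}^\top)\,r$, $t\ge1$, do not satisfy $\lim_{t\to\infty}\pi_{\theta_t}(1)=1$.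
   Context: For $\theta\in\mathbb{R}^d$, $\pi_\theta=\mathrm{softmax}(X\theta)$, i.e. $\pi_\theta(a)=\exp(\langle x_a,\theta\rangle)/\sum_{a'}\exp(\langle x_{a'},\theta\rangle)$, where $x_a$ is the $a$-th row of $X$. *)

theory Defs
  imports "HOL-Analysis.Analysis"
begin

definition softmax :: "real^'k \<Rightarrow> real^'k" where
  "softmax z = (\<chi> a. exp (z $ a) / (\<Sum>b\<in>UNIV. exp (z $ b)))"

definition policy :: "real^'d^'k \<Rightarrow> real^'d \<Rightarrow> real^'k" where
  "policy X \<theta> = softmax (X *v \<theta>)"

definition diag :: "real^'k \<Rightarrow> real^'k^'k" where
  "diag p = (\<chi> i j. if i = j then p $ i else 0)"

definition outer :: "real^'m \<Rightarrow> real^'n \<Rightarrow> real^'n^'m" where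
  "outer p q = (\<chi> i j. p $ i * q $ j)"

definition softmax_PG_step :: "real^'d^'k \<Rightarrow> real^'k \<Rightarrow> real \<Rightarrow> real^'d \<Rightarrow> real^'d" where
  "softmax_PG_step X r \<eta> \<theta> =
     \<theta> + \<eta> *\<^sub>R (transpose X *v ((diag (policy X \<theta>) - outer (policy X \<theta>) (policy X \<theta>)) *v r))"

end

(* The row x_1 is the midpoint of x_2 and x_3, so pi(1) is the geometric mean of pi(2) and pi(3)
   for every parameter; by AM-GM, pi(1) <= 1/3. This bounds the reward away from r(1) = 3. *)
theory Submission
  imports Defs
begin

text \<open>Everything negative in the statement comes from one linear relation among the rows,
  which passes to every logit vector \<open>X *v w\<close>: its first entry is the average of the
  other two. An average cannot strictly exceed both terms, so no linear reward ranks action 1 first.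
  For the policy, \<open>softmax_midpoint_le\<close> gives a bound uniform in the parameter, and
  uniform bounds survive limits along any sequence.\<close>

lemma softmax_pos: "softmax z $ a > 0"
  unfolding softmax_def by (simp add: sum_pos)

lemma sum_softmax: "(\<Sum>a\<in>UNIV. softmax z $ a) = 1"
proof -
  have "(\<Sum>b\<in>UNIV. exp (z $ b)) > 0"
    by (simp add: sum_pos)
  then show ?thesis
    by (simp add: softmax_def flip: sum_divide_distrib)
qed

lemma softmax_midpoint_le:
  fixes z :: "real^3"
  assumes "z $ 1 = (z $ 2 + z $ 3) / 2"
  shows "softmax z $ 1 \<le> 1 / 3"
proof -
  \<comment> \<open>Halving the exponents makes all three weights monomials \<open>u * v\<close>,
    \<open>u * u\<close>, \<open>v * v\<close>; after clearing the positive denominator, the claim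
    is exactly \<open>2 * (u * v) \<le> u * u + v * v\<close>.\<close>
  define u v where "u = exp (z $ 2 / 2)" and "v = exp (z $ 3 / 2)"
  have e: "exp (z $ 1) = u * v" "exp (z $ 2) = u * u" "exp (z $ 3) = v * v"
    using assms by (simp_all add: u_def v_def add_divide_distrib flip: exp_add)
  have "u > 0" "v > 0"
    by (simp_all add: u_def v_def)
  then have "u * v + u * u + v * v > 0"
    by (simp add: add_pos_pos)
  moreover have "2 * (u * v) \<le> u * u + v * v"
    using sum_squares_bound[of u v] by (simp add: power2_eq_square)
  ultimately show ?thesis
    by (simp add: softmax_def sum_3 e divide_simps)
qed

theorem proposition14:
  fixes X :: "real^2^3" and r :: "real^3"
  assumes X: "X = vector [vector [3, 4], vector [5, 6], vector [1, 2]]"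
    and r: "r = vector [3, 2, 1]"
  shows "(\<forall>i j. i \<noteq> j \<longrightarrow> r $ i \<noteq> r $ j)
    \<and> (X $ 2 - X $ 3) \<bullet> (X $ 1 - X $ 3) > 0
    \<and> \<not> (\<exists>w :: real^2. \<forall>i j. (X *v w) $ i > (X *v w) $ j \<longleftrightarrow> r $ i > r $ j)
    \<and> \<not> (\<exists>\<theta> :: real^2. policy X \<theta> \<bullet> r = r $ 1)
    \<and> \<not> (\<exists>\<theta> :: nat \<Rightarrow> real^2. (\<lambda>n. policy X (\<theta> n) \<bullet> r) \<longlonglongrightarrow> r $ 1)
    \<and> (\<forall>(\<theta> :: nat \<Rightarrow> real^2) (\<eta> :: real).
          \<eta> > 0 \<longrightarrow> (\<forall>t\<ge>1. \<theta> (t + 1) = softmax_PG_step X r \<eta> (\<theta> t)) \<longrightarrow>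
          \<not> (\<lambda>t. policy X (\<theta> t) $ 1) \<longlonglongrightarrow> 1)"
proof -
  have mid: "(X *v w) $ 1 = ((X *v w) $ 2 + (X *v w) $ 3) / 2" for w
    by (simp add: X matrix_vector_mult_def sum_2)
  have p1: "policy X w $ 1 \<le> 1 / 3" for w
    unfolding policy_def by (rule softmax_midpoint_le[OF mid])
  \<comment> \<open>As the probabilities sum to 1, the expected reward equals 2 + \<pi>(1) -
    \<pi>(3), which is below 2 + 1/3.\<close>
  have val: "policy X w \<bullet> r \<le> 7 / 3" for w
  proof -
    have "policy X w $ 1 + policy X w $ 2 + policy X w $ 3 = 1"
      using sum_softmax[of "X *v w"] by (simp add: policy_def sum_3)
    moreover have "policy X w $ 3 > 0"
      by (simp add: policy_def softmax_pos)
    moreover have "policy X w \<bullet> r = 3 * policy X w $ 1 + 2 * policy X w $ 2 + policy X w $ 3"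
      by (simp add: r inner_vec_def sum_3)
    ultimately show ?thesis
      using p1[of w] by linarith
  qed
  have "\<forall>i j. i \<noteq> j \<longrightarrow> r $ i \<noteq> r $ j"
    by (simp add: r forall_3)
  moreover have "(X $ 2 - X $ 3) \<bullet> (X $ 1 - X $ 3) > 0"
    by (simp add: X inner_vec_def sum_2)
  moreover have "\<not> (\<exists>w. \<forall>i j. (X *v w) $ i > (X *v w) $ j \<longleftrightarrow> r $ i > r $ j)"
  proof
    assume "\<exists>w. \<forall>i j. (X *v w) $ i > (X *v w) $ j \<longleftrightarrow> r $ i > r $ j"
    then obtain w where w: "\<And>i j. (X *v w) $ i > (X *v w) $ j \<longleftrightarrow> r $ i > r $ j"
      by blast
    have "(X *v w) $ 1 > (X *v w) $ 2" "(X *v w) $ 1 > (X *v w) $ 3"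
      unfolding w by (simp_all add: r)
    moreover have "2 * (X *v w) $ 1 = (X *v w) $ 2 + (X *v w) $ 3"
      by (subst mid) simp
    ultimately show False
      by linarith
  qed
  moreover have "policy X w \<bullet> r \<noteq> r $ 1" for w
    using val[of w] by (auto simp: r)
  moreover have "\<not> (\<lambda>n. policy X (\<theta> n) \<bullet> r) \<longlonglongrightarrow> r $ 1" for \<theta>
  proof
    assume "(\<lambda>n. policy X (\<theta> n) \<bullet> r) \<longlonglongrightarrow> r $ 1"
    then have "r $ 1 \<le> 7 / 3"
      by (rule LIMSEQ_le_const2) (use val in blast)
    then show False
      by (simp add: r)
  qed
  \<comment> \<open>Shown for an arbitrary sequence of parameters, hence for the gradient iterates
    with any initialization and step size.\<close>
  moreover have "\<not> (\<lambda>t. policy X (\<theta> t) $ 1) \<longlonglongrightarrow> 1" for \<theta>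
  proof
    assume "(\<lambda>t. policy X (\<theta> t) $ 1) \<longlonglongrightarrow> 1"
    then have "(1 :: real) \<le> 1 / 3"
      by (rule LIMSEQ_le_const2) (use p1 in blast)
    then show False
      by simp
  qed
  ultimately show ?thesis
    by (intro conjI) simp_all
qed

end
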